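(* Let $\varrho=h^4$ and $\mathbf{A}_h=\mathbf{M}_h+\varrho^{1/2}\mathbf{K}_h=\mathbf{M}_h+h^2\mathbf{K}_h$, where $\mathbf{M}_h,\mathbf{K}_h$ are the finite element mass and stiffness matrices. Let $\underline{c}_{MK},\overline{c}_{MK}>0$ be $h$-independent constants with $\underline{c}_{MK}\le\lambda_{\min}(\mathbf{M}_h^{-1}\mathbf{K}_h)$ and $\lambda_{\max}(\mathbf{M}_h^{-1}\mathbf{K}_h)\le\overline{c}_{MK}h^{-2}$. Then for all $\mathbf{v}\in\mathbb{R}^{N_h}$ $$(1+h^2\underline{c}_{MK})\,(\mathbf{M}_h\mathbf{v},\mathbf{v})\le(\mathbf{A}_h\mathbf{v},\mathbf{v})\le(1+\overline{c}_{MK})\,(\mathbf{M}_h\mathbf{v},\mathbf{v}).$$ Moreover, with $\mathbf{C}_h=\mathrm{diag}(\mathbf{M}_h)$, there exist positive constants $\underline{c}_{CA},\overline{c}_{CA}$ independent of $h$ such that for all $\mathbf{v}\in\mathbb{R}^{N_h}$ $$\underline{c}_{CA}\,(\mathbf{C}_h\mathbf{v},\mathbf{v})\le(\mathbf{A}_h\mathbf{v},\mathbf{v})\le\overline{c}_{CA}\,(\mathbf{C}_h\mathbf{v},\mathbf{v}).$$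
   Context: $\Omega\subset\mathbb{R}^d$, $d\in\{1,2,3\}$, is a bounded Lipschitz domain, decomposed admissibly into shape regular, globally quasi-uniform simplices of mesh size $h$. $V_h=\mathrm{span}\{\varphi_k\}_{k=1}^{N_h}\subset H^1_0(\Omega)$ is the space of continuous piecewise linear functions vanishing on $\partial\Omega$, with nodal basis $\varphi_k$. The mass and stiffness matrices are $\mathbf{M}_h[\ell,k]=\int_\Omega\varphi_k\varphi_\ell\,dx$ and $\mathbf{K}_h[\ell,k]=\int_\Omega\nabla\varphi_k\cdot\nabla\varphi_\ell\,dx$, both symmetric positive definite. $(\cdot,\cdot)$ is the Euclidean inner product in $\mathbb{R}^{N_h}$; $\lambda_{\min},\lambda_{\max}$ denote extreme eigenvalues; $\mathrm{diag}(\mathbf{M}_h)$ is the diagonal matrix with the diagonal entries of $\mathbf{M}_h$. Constants $\underline{c}_{MK},\overline{c}_{MK}$ as described exist for such meshes; constants "independent of $h$" may depend on $\Omega$ and the shape-regularity and quasi-uniformity constants of the mesh family. *)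

theory Defs
  imports
    "HOL-Analysis.Analysis"
    "Jordan_Normal_Form.Char_Poly"
    "Jordan_Normal_Form.Gauss_Jordan_Elimination"
begin

section \<open>Lipschitz domains\<close>

text \<open>
  Near each boundary point, in suitable orthonormal coordinates with last axis \<open>n\<close>, the domain is
  the strict epigraph of a Lipschitz function \<open>\<gamma>\<close> of the other coordinates. The hyperplane
  orthogonal to \<open>n\<close> carries these other coordinates; \<open>y - (y \<bullet> n) n\<close> is the projection onto it.
\<close>

definition bounded_lipschitz_domain :: "(real ^ 'd) set \<Rightarrow> bool" where
  "bounded_lipschitz_domain \<Omega> \<longleftrightarrow>
     bounded \<Omega> \<and> open \<Omega> \<and> connected \<Omega> \<and> \<Omega> \<noteq> {} \<and>
     (\<forall>p \<in> frontier \<Omega>. \<exists>n r L \<gamma>.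
        norm n = 1 \<and> 0 < r \<and> L-lipschitz_on {z. inner z n = 0} \<gamma> \<and>
        \<Omega> \<inter> ball p r = {y \<in> ball p r. \<gamma> (y - inner y n *\<^sub>R n) < inner y n})"


section \<open>Simplicial meshes\<close>

text \<open>
  The library predicate \<^const>\<open>triangulation\<close> is the admissibility condition: a finite set of
  simplices, any two of which meet in a common (possibly empty) face.
\<close>

definition admissible_mesh :: "(real ^ 'd) set \<Rightarrow> (real ^ 'd) set set \<Rightarrow> bool" where
  "admissible_mesh \<Omega> \<T> \<longleftrightarrow>
     triangulation \<T> \<and> (\<forall>K \<in> \<T>. int CARD('d) simplex K) \<and> \<Union>\<T> = closure \<Omega>"

definition mesh_size :: "(real ^ 'd) set set \<Rightarrow> real" where
  "mesh_size \<T> = Max (diameter ` \<T>)"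

text \<open>Diameter of the largest ball contained in \<open>K\<close>.\<close>

definition inball_diameter :: "(real ^ 'd) set \<Rightarrow> real" where
  "inball_diameter K = Sup {2 * r | r c. 0 \<le> r \<and> cball c r \<subseteq> K}"

definition shape_regular :: "real \<Rightarrow> (real ^ 'd) set set \<Rightarrow> bool" where
  "shape_regular \<sigma> \<T> \<longleftrightarrow> (\<forall>K \<in> \<T>. diameter K \<le> \<sigma> * inball_diameter K)"

definition quasi_uniform :: "real \<Rightarrow> (real ^ 'd) set set \<Rightarrow> bool" where
  "quasi_uniform \<kappa> \<T> \<longleftrightarrow> (\<forall>K \<in> \<T>. mesh_size \<T> \<le> \<kappa> * diameter K)"


section \<open>Piecewise linear finite elements\<close>

text \<open>
  Finite element functions are extended by zero outside the closed domain, so that they are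
  determined by their values on it.
\<close>

definition fe_space :: "(real ^ 'd) set \<Rightarrow> (real ^ 'd) set set \<Rightarrow> (real ^ 'd \<Rightarrow> real) set" where
  "fe_space \<Omega> \<T> =
     {v. continuous_on (closure \<Omega>) v \<and>
         (\<forall>K \<in> \<T>. \<exists>a b. \<forall>x \<in> K. v x = inner a x + b) \<and>
         (\<forall>x \<in> frontier \<Omega>. v x = 0) \<and>
         (\<forall>x. x \<notin> closure \<Omega> \<longrightarrow> v x = 0)}"

text \<open>As \<open>\<Omega>\<close> is open, the vertices lying in \<open>\<Omega>\<close> are those not on the boundary.\<close>

definition interior_nodes :: "(real ^ 'd) set \<Rightarrow> (real ^ 'd) set set \<Rightarrow> (real ^ 'd) set" where
  "interior_nodes \<Omega> \<T> = {p \<in> \<Omega>. \<exists>K \<in> \<T>. p extreme_point_of K}"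

definition num_dofs :: "(real ^ 'd) set \<Rightarrow> (real ^ 'd) set set \<Rightarrow> nat" where
  "num_dofs \<Omega> \<T> = card (interior_nodes \<Omega> \<T>)"

text \<open>Basis functions and nodes are indexed from 0; the numbering \<open>x\<close> of the nodes is arbitrary.\<close>

definition nodal_basis ::
  "(real ^ 'd) set \<Rightarrow> (real ^ 'd) set set \<Rightarrow> (nat \<Rightarrow> real ^ 'd \<Rightarrow> real) \<Rightarrow> bool" where
  "nodal_basis \<Omega> \<T> \<phi> \<longleftrightarrow>
     (\<exists>x. bij_betw x {..<num_dofs \<Omega> \<T>} (interior_nodes \<Omega> \<T>) \<and>
          (\<forall>k < num_dofs \<Omega> \<T>. \<phi> k \<in> fe_space \<Omega> \<T> \<and>
             (\<forall>l < num_dofs \<Omega> \<T>. \<phi> k (x l) = (if l = k then 1 else 0))))"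

definition fe_discretization ::
  "(real ^ 'd) set \<Rightarrow> real \<Rightarrow> real \<Rightarrow> (real ^ 'd) set set \<Rightarrow> (nat \<Rightarrow> real ^ 'd \<Rightarrow> real) \<Rightarrow> bool" where
  "fe_discretization \<Omega> \<sigma> \<kappa> \<T> \<phi> \<longleftrightarrow>
     admissible_mesh \<Omega> \<T> \<and> shape_regular \<sigma> \<T> \<and> quasi_uniform \<kappa> \<T> \<and> nodal_basis \<Omega> \<T> \<phi>"

text \<open>
  A finite element function is affine on each simplex, so its weak gradient is its classical gradient
  at all points outside the simplex boundaries. The value at points of
  non-differentiability, which form a null set, is irrelevant below.
\<close>

definition gradient :: "(real ^ 'd \<Rightarrow> real) \<Rightarrow> real ^ 'd \<Rightarrow> real ^ 'd" where
  "gradient f x = (THE D. GDERIV f x :> D)"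


section \<open>Finite element matrices\<close>

definition mass_matrix ::
  "(real ^ 'd) set \<Rightarrow> (real ^ 'd) set set \<Rightarrow> (nat \<Rightarrow> real ^ 'd \<Rightarrow> real) \<Rightarrow> real mat" where
  "mass_matrix \<Omega> \<T> \<phi> =
     Matrix.mat (num_dofs \<Omega> \<T>) (num_dofs \<Omega> \<T>)
       (\<lambda>(l, k). LINT x:\<Omega>|lebesgue. \<phi> k x * \<phi> l x)"

definition stiffness_matrix ::
  "(real ^ 'd) set \<Rightarrow> (real ^ 'd) set set \<Rightarrow> (nat \<Rightarrow> real ^ 'd \<Rightarrow> real) \<Rightarrow> real mat" where
  "stiffness_matrix \<Omega> \<T> \<phi> =
     Matrix.mat (num_dofs \<Omega> \<T>) (num_dofs \<Omega> \<T>)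
       (\<lambda>(l, k). LINT x:\<Omega>|lebesgue. inner (gradient (\<phi> k) x) (gradient (\<phi> l) x))"

definition A_matrix ::
  "real \<Rightarrow> (real ^ 'd) set \<Rightarrow> (real ^ 'd) set set \<Rightarrow> (nat \<Rightarrow> real ^ 'd \<Rightarrow> real) \<Rightarrow> real mat" where
  "A_matrix \<rho> \<Omega> \<T> \<phi> = mass_matrix \<Omega> \<T> \<phi> + sqrt \<rho> \<cdot>\<^sub>m stiffness_matrix \<Omega> \<T> \<phi>"

definition diag_part :: "real mat \<Rightarrow> real mat" where
  "diag_part M = mat_diag (dim_row M) (\<lambda>k. M $$ (k, k))"

text \<open>
  The extreme eigenvalues are taken over the real eigenvalues. For \<open>M\<inverse> K\<close> with \<open>M\<close> symmetric positive
  definite and \<open>K\<close> symmetric these are all eigenvalues.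
\<close>

definition lambda_min :: "real mat \<Rightarrow> real" where
  "lambda_min A = Min {k. eigenvalue A k}"

definition lambda_max :: "real mat \<Rightarrow> real" where
  "lambda_max A = Max {k. eigenvalue A k}"

text \<open>
  A mesh without interior nodes gives empty matrices, which have no eigenvalues; nothing is required
  of \<open>c\<close> and \<open>C\<close> for such a mesh. \<^const>\<open>mat_inverse\<close> returns an option.
\<close>

definition MK_spectral_bounds ::
  "real \<Rightarrow> real \<Rightarrow> (real ^ 'd) set \<Rightarrow> (real ^ 'd) set set \<Rightarrow> (nat \<Rightarrow> real ^ 'd \<Rightarrow> real) \<Rightarrow> bool" where
  "MK_spectral_bounds c C \<Omega> \<T> \<phi> \<longleftrightarrow>
     (0 < num_dofs \<Omega> \<T> \<longrightarrow>
       (let MK = the (mat_inverse (mass_matrix \<Omega> \<T> \<phi>)) * stiffness_matrix \<Omega> \<T> \<phi>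
        in c \<le> lambda_min MK \<and> lambda_max MK \<le> C / (mesh_size \<T>)\<^sup>2))"

definition quad_form :: "real mat \<Rightarrow> real Matrix.vec \<Rightarrow> real" where
  "quad_form A v = scalar_prod (A *\<^sub>v v) v"

end

(*
  The spectral bounds say c <= (Kv,v)/(Mv,v) <= C/h^2, because the extreme values of this Rayleigh
  quotient are attained, and at an extremal vector the semidefinite matrix K - mu M has v in its
  kernel, so that mu is an eigenvalue of M^-1 K. Multiplying by h^2 compares A with M.

  For M against diag(M) with f = sum v_k phi_k: at each point at most d + 1 basis functions are
  nonzero, so Cauchy-Schwarz gives f^2 <= (d + 1) sum v_k^2 phi_k^2. Conversely, on a simplex K with
  vertex p, affinity gives f(p) = 2 f((p + x)/2) - f(x), whence |K| f(p)^2 is at most a constant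
  times the integral of f^2 over K, while 0 <= phi_k <= 1 bounds the integral of phi_k^2 over K by
  |K|.
*)
theory Submission
  imports Defs
begin

section \<open>Generalized Rayleigh quotients\<close>

text \<open>The inverse of \<open>M\<close> times \<open>K\<close> is in general not symmetric
  although both factors are, so no spectral theorem for symmetric matrices applies to it directly.
  Hence the proof works with the pencil \<open>K v = \<mu> M v\<close>. It is enough that the
  extremal value of the quotient belongs to the finite set of eigenvalues over which
  \<open>lambda_min\<close> takes its minimum; the maximum comes from the minimum for
  \<open>-K\<close>. The midpoint identity takes the place of an explicit element mass matrix on a
  reference simplex. It costs the Jacobian \<open>2 ^ d\<close> of the homothety with ratio 1/2,
  which is where \<open>8 * 2 ^ d + 2\<close> originates. Since |K| stands next to values of f on
  the same simplex, sizes of different simplices are never compared. The resulting constants depend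
  only on d and on the given upper spectral constant, so they can be chosen before the mesh, as the
  order of the quantifiers demands.\<close>

lemma quad_form_eq_sum:
  assumes "A \<in> carrier_mat n n" "v \<in> carrier_vec n"
  shows "quad_form A v = (\<Sum>l<n. \<Sum>k<n. A $$ (l, k) * v $ k * v $ l)"
  using assms
  by (auto simp: quad_form_def scalar_prod_def lessThan_atLeast0 sum_distrib_right intro!: sum.cong)

lemma quad_form_add_mat:
  assumes "A \<in> carrier_mat n n" "B \<in> carrier_mat n n" "v \<in> carrier_vec n"
  shows "quad_form (A + B) v = quad_form A v + quad_form B v"
  using assms by (simp add: quad_form_eq_sum[of _ n] sum.distrib ring_distribs)

lemma quad_form_smult_mat:
  assumes "A \<in> carrier_mat n n" "v \<in> carrier_vec n"
  shows "quad_form (c \<cdot>\<^sub>m A) v = c * quad_form A v"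
  using assms by (simp add: quad_form_eq_sum[of _ n] sum_distrib_left mult.assoc)

lemma quad_form_smult_vec:
  assumes "A \<in> carrier_mat n n" "v \<in> carrier_vec n"
  shows "quad_form A (t \<cdot>\<^sub>v v) = t\<^sup>2 * quad_form A v"
  using assms by (simp add: quad_form_eq_sum[of _ n] sum_distrib_left power2_eq_square ac_simps)

lemma quad_form_add_vec:
  assumes A: "A \<in> carrier_mat n n" "A\<^sup>T = A" and v: "v \<in> carrier_vec n" and w: "w \<in> carrier_vec n"
  shows "quad_form A (v + w) = quad_form A v + 2 * ((A *\<^sub>v v) \<bullet> w) + quad_form A w"
proof -
  have "(A *\<^sub>v w) \<bullet> v = w \<bullet> (A *\<^sub>v v)"
    using transpose_vec_mult_scalar[OF A(1) v w] A by simp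
  also have "\<dots> = (A *\<^sub>v v) \<bullet> w"
    using A v w by (intro comm_scalar_prod[of _ n]) auto
  finally have "(A *\<^sub>v w) \<bullet> v = (A *\<^sub>v v) \<bullet> w" .
  then show ?thesis
    using A v w
    by (simp add: quad_form_def mult_add_distrib_mat_vec[of _ n n] add_scalar_prod_distrib[of _ n]
        scalar_prod_add_distrib[of _ n])
qed

lemma transpose_smult_mat: "(c \<cdot>\<^sub>m A)\<^sup>T = c \<cdot>\<^sub>m A\<^sup>T"
  by (intro eq_matI) auto

lemma smult_mat_mult_vec:
  assumes "A \<in> carrier_mat nr nc" "v \<in> carrier_vec nc"
  shows "(c \<cdot>\<^sub>m A) *\<^sub>v v = c \<cdot>\<^sub>v (A *\<^sub>v v)"
  using assms by (intro eq_vecI) (auto intro!: smult_scalar_prod_distrib[of _ nc])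

text \<open>A zero of a nonnegative form is a minimum, so the form has zero slope there in every
  direction. In the direction \<open>A v\<close> this slope is twice the squared length of
  \<open>A v\<close>.\<close>

lemma psd_quad_form_eq_0_imp_kernel:
  assumes A: "A \<in> carrier_mat n n" "A\<^sup>T = A"
    and psd: "\<And>w. w \<in> carrier_vec n \<Longrightarrow> 0 \<le> quad_form A w"
    and v: "v \<in> carrier_vec n" and 0: "quad_form A v = 0"
  shows "A *\<^sub>v v = 0\<^sub>v n"
proof -
  define w where "w = A *\<^sub>v v"
  define s where "s = w \<bullet> w"
  define q where "q = quad_form A w"
  have w: "w \<in> carrier_vec n" using A v by (simp add: w_def)
  have s: "s = (\<Sum>k<n. (w $ k)\<^sup>2)"
    using w by (simp add: s_def scalar_prod_def lessThan_atLeast0 power2_eq_square)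
  have q: "0 \<le> q" using psd[OF w] by (simp add: q_def)
  have pos: "0 \<le> 2 * t * s + t\<^sup>2 * q" for t
  proof -
    have "quad_form A (v + t \<cdot>\<^sub>v w) = 2 * t * s + t\<^sup>2 * q"
      using A v w 0 by (subst quad_form_add_vec[of _ n])
        (auto simp: quad_form_smult_vec[of _ n] s_def q_def simp flip: w_def)
    then show ?thesis using psd[of "v + t \<cdot>\<^sub>v w"] v w by simp
  qed
  have "s = 0"
  proof (rule ccontr)
    assume "s \<noteq> 0"
    then have "0 < s\<^sup>2" by simp
    \<comment> \<open>The shift by 1 keeps the denominator positive when \<open>q = 0\<close>; the
      step \<open>t = - s / r\<close> then makes the quadratic polynomial negative.\<close>
    define r where "r = q + 1"
    have r: "0 < r" "q = r - 1" using q by (simp_all add: r_def)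
    have "2 * (- s / r) * s + (- s / r)\<^sup>2 * q = - (s\<^sup>2 * (r + 1)) / r\<^sup>2"
      using r(1) unfolding r(2) by (simp add: field_simps power2_eq_square)
    moreover have "0 < s\<^sup>2 * (r + 1) / r\<^sup>2"
      using r(1) \<open>0 < s\<^sup>2\<close> by (intro divide_pos_pos mult_pos_pos) auto
    ultimately show False using pos[of "- s / r"] by simp
  qed
  then have "w $ k = 0" if "k < n" for k
    using that unfolding s by (simp add: sum_nonneg_eq_0_iff)
  then show ?thesis using w by (auto simp: w_def[symmetric])
qed

text \<open>Vectors of variable length \<open>n\<close> are modelled by functions that vanish from
  \<open>n\<close> on, so that the product topology is at hand: the box \<open>?B\<close> is compact
  by Tychonoff, and the sphere is a closed part of it.\<close>

lemma compact_unit_sphere_nat: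
  "compact {f :: nat \<Rightarrow> real. (\<forall>k\<ge>n. f k = 0) \<and> (\<Sum>k<n. (f k)\<^sup>2) = 1}" (is "compact ?S")
proof -
  let ?B = "PiE UNIV (\<lambda>k. if k < n then {-1..1} else {0}) :: (nat \<Rightarrow> real) set"
  have "compactin (product_topology (\<lambda>_. euclidean) UNIV) ?B"
    by (subst compactin_PiE) auto
  then have "compact ?B"
    by (simp add: euclidean_product_topology)
  moreover have "closed {f :: nat \<Rightarrow> real. (\<Sum>k<n. (f k)\<^sup>2) = 1}"
    by (intro closed_Collect_eq continuous_intros continuous_on_product_coordinates)
  ultimately have "compact (?B \<inter> {f. (\<Sum>k<n. (f k)\<^sup>2) = 1})"
    by (rule compact_Int_closed)
  moreover have "?B \<inter> {f. (\<Sum>k<n. (f k)\<^sup>2) = 1} = ?S"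
  proof -
    have "\<bar>f k\<bar> \<le> 1" if "(\<Sum>k<n. (f k)\<^sup>2) = 1" "k < n" for f :: "nat \<Rightarrow> real" and k
    proof -
      have "(f k)\<^sup>2 \<le> (\<Sum>k<n. (f k)\<^sup>2)" using that by (intro member_le_sum) auto
      then show ?thesis using that by (simp add: abs_square_le_1)
    qed
    then show ?thesis by (auto simp: PiE_iff abs_le_iff split: if_splits)
  qed
  ultimately show ?thesis by simp
qed

text \<open>The eigenvector equation is stated for the pencil rather than with an inverse because
  \<open>K - \<mu> M\<close> stays symmetric, and symmetry is what turns a zero of its form into a
  kernel vector.\<close>

lemma generalized_rayleigh_minimizer:
  fixes K M :: "real mat"
  assumes M: "M \<in> carrier_mat n n" "M\<^sup>T = M" and K: "K \<in> carrier_mat n n" "K\<^sup>T = K" and "0 < n"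
    and pd: "\<And>v. v \<in> carrier_vec n \<Longrightarrow> v \<noteq> 0\<^sub>v n \<Longrightarrow> 0 < quad_form M v"
  obtains \<mu> v where "v \<in> carrier_vec n" "v \<noteq> 0\<^sub>v n" "K *\<^sub>v v = \<mu> \<cdot>\<^sub>v (M *\<^sub>v v)"
    "\<And>w. w \<in> carrier_vec n \<Longrightarrow> \<mu> * quad_form M w \<le> quad_form K w"
proof -
  let ?S = "{f :: nat \<Rightarrow> real. (\<forall>k\<ge>n. f k = 0) \<and> (\<Sum>k<n. (f k)\<^sup>2) = 1}"
  define Q where "Q A f = (\<Sum>l<n. \<Sum>k<n. A $$ (l, k) * f k * f l)" for A and f :: "nat \<Rightarrow> real"
  have Q: "quad_form A (Matrix.vec n f) = Q A f" if "A \<in> carrier_mat n n" for A f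
    using that by (simp add: quad_form_eq_sum[of _ n] Q_def)
  have nz: "Matrix.vec n f \<noteq> 0\<^sub>v n" if "f \<in> ?S" for f
  proof
    assume "Matrix.vec n f = 0\<^sub>v n"
    then have "f k = 0" if "k < n" for k
      using that by (metis index_vec index_zero_vec(1))
    then show False using \<open>f \<in> ?S\<close> by simp
  qed
  have Mpos: "0 < Q M f" if "f \<in> ?S" for f
    using pd[OF _ nz[OF that]] Q[OF M(1)] by simp
  have ne: "?S \<noteq> {}"
  proof -
    define e :: "nat \<Rightarrow> real" where "e k = (if k = 0 then 1 else 0)" for k
    have "(\<Sum>k<n. (e k)\<^sup>2) = (\<Sum>k<n. if k = 0 then 1 else 0)"
      unfolding e_def by (intro sum.cong) auto
    also have "\<dots> = 1" using \<open>0 < n\<close> by (subst sum.delta) auto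
    finally have "(\<Sum>k<n. (e k)\<^sup>2) = 1" .
    moreover have "\<forall>k\<ge>n. e k = 0" using \<open>0 < n\<close> by (simp add: e_def)
    ultimately show ?thesis by blast
  qed
  have "continuous_on ?S (\<lambda>f. Q K f / Q M f)"
  proof -
    have c: "continuous_on ?S (\<lambda>f. f i)" for i
      by (rule continuous_on_subset[OF continuous_on_product_coordinates]) auto
    have "continuous_on ?S (Q A)" for A
      unfolding Q_def[abs_def] by (intro continuous_intros c)
    moreover have "\<forall>f\<in>?S. Q M f \<noteq> 0"
      by (intro ballI less_imp_neq[symmetric] Mpos)
    ultimately show ?thesis
      by (intro continuous_on_divide)
  qed
  from continuous_attains_inf[OF compact_unit_sphere_nat ne this]
  obtain f where f: "f \<in> ?S" and min: "\<And>g. g \<in> ?S \<Longrightarrow> Q K f / Q M f \<le> Q K g / Q M g"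
    by blast
  define \<mu> where "\<mu> = Q K f / Q M f"
  define v where "v = Matrix.vec n f"
  have v: "v \<in> carrier_vec n" by (simp add: v_def)
  have le: "\<mu> * quad_form M w \<le> quad_form K w" if w: "w \<in> carrier_vec n" for w
  proof (cases "w = 0\<^sub>v n")
    case True
    then show ?thesis using M K by (simp add: quad_form_eq_sum[of _ n])
  next
    case False
    \<comment> \<open>Both forms scale with \<open>s\<^sup>2\<close>, so the bound on the unit
      sphere extends to every nonzero \<open>w\<close> by normalizing it to
      \<open>g\<close>.\<close>
    define s where "s = sqrt (\<Sum>k<n. (w $ k)\<^sup>2)"
    have "\<exists>k<n. w $ k \<noteq> 0" using False w by (auto simp: vec_eq_iff)
    then have "0 < (\<Sum>k<n. (w $ k)\<^sup>2)" by (auto intro: sum_pos2)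
    then have s: "0 < s" "s\<^sup>2 = (\<Sum>k<n. (w $ k)\<^sup>2)" by (simp_all add: s_def)
    define g where "g k = (if k < n then w $ k / s else 0)" for k
    have g: "g \<in> ?S"
      using s by (auto simp: g_def power_divide sum_divide_distrib[symmetric])
    have "w = s \<cdot>\<^sub>v Matrix.vec n g"
      using w s by (auto simp: g_def)
    then have "quad_form A w = s\<^sup>2 * Q A g" if "A \<in> carrier_mat n n" for A
      using that by (simp add: quad_form_smult_vec[of _ n] Q)
    moreover have "\<mu> * Q M g \<le> Q K g"
      using min[OF g] Mpos[OF g] by (simp add: \<mu>_def pos_le_divide_eq)
    ultimately show ?thesis
      using M K s(1) by (simp add: mult.left_commute)
  qed
  let ?B = "K + (- \<mu>) \<cdot>\<^sub>m M"
  have B: "?B \<in> carrier_mat n n" using M K by simp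
  have qB: "quad_form ?B w = quad_form K w - \<mu> * quad_form M w" if "w \<in> carrier_vec n" for w
    using M K that by (subst quad_form_add_mat[of _ n]) (auto simp: quad_form_smult_mat[of _ n])
  have BT: "?B\<^sup>T = ?B"
    using M K by (subst transpose_add[of _ n n]) (auto simp: transpose_smult_mat)
  have "?B *\<^sub>v v = 0\<^sub>v n"
  proof (rule psd_quad_form_eq_0_imp_kernel[OF B BT _ v])
    show "quad_form ?B v = 0"
      unfolding qB[OF v] using M K Mpos[OF f] by (simp add: v_def Q \<mu>_def)
  qed (use le qB in auto)
  then have ker: "(K *\<^sub>v v) + (- \<mu>) \<cdot>\<^sub>v (M *\<^sub>v v) = 0\<^sub>v n"
    using M K v by (simp add: add_mult_distrib_mat_vec[of _ n n] smult_mat_mult_vec[of _ n n])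
  have "K *\<^sub>v v = \<mu> \<cdot>\<^sub>v (M *\<^sub>v v)"
  proof (rule eq_vecI)
    fix i assume "i < dim_vec (\<mu> \<cdot>\<^sub>v (M *\<^sub>v v))"
    then show "(K *\<^sub>v v) $ i = (\<mu> \<cdot>\<^sub>v (M *\<^sub>v v)) $ i"
      using arg_cong[OF ker, of "\<lambda>u. u $ i"] M(1) K(1) by simp
  qed (use M K in simp)
  then show ?thesis
    by (intro that[OF v _ _ le]) (use nz[OF f] v_def in simp_all)
qed

section \<open>From the pencil to the eigenvalues of the inverse of \<open>M\<close> times
  \<open>K\<close>\<close>

lemma mat_inverse_pos_def:
  fixes M :: "real mat"
  assumes M: "M \<in> carrier_mat n n"
    and pd: "\<And>v. v \<in> carrier_vec n \<Longrightarrow> v \<noteq> 0\<^sub>v n \<Longrightarrow> 0 < quad_form M v"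
  shows "the (mat_inverse M) \<in> carrier_mat n n" "the (mat_inverse M) * M = 1\<^sub>m n"
proof -
  \<comment> \<open>A kernel vector would make the form 0, against definiteness. Invertibility then
    guarantees that \<open>mat_inverse\<close> returns \<open>Some\<close>, so that
    \<open>the\<close> yields the inverse.\<close>
  have "det M \<noteq> 0"
  proof
    assume "det M = 0"
    then obtain v where v: "v \<in> carrier_vec n" "v \<noteq> 0\<^sub>v n" "M *\<^sub>v v = 0\<^sub>v n"
      using det_0_iff_vec_prod_zero[OF M] by blast
    then show False using pd[of v] by (simp add: quad_form_def)
  qed
  then have "M \<in> Units (ring_mat TYPE(real) n ())"
    by (rule det_non_zero_imp_unit[OF M])
  then obtain B where "mat_inverse M = Some B"
    using mat_inverse(1)[OF M, of "()"] by (cases "mat_inverse M") auto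
  then show "the (mat_inverse M) \<in> carrier_mat n n" "the (mat_inverse M) * M = 1\<^sub>m n"
    using mat_inverse(2)[OF M] by auto
qed

text \<open>Finiteness is what makes \<open>Min\<close> and \<open>Max\<close> in
  \<open>lambda_min\<close> and \<open>lambda_max\<close> bound every eigenvalue.\<close>

lemma finite_eigenvalues:
  fixes A :: "real mat"
  assumes "A \<in> carrier_mat n n"
  shows "finite {k. eigenvalue A k}"
proof -
  have "char_poly A \<noteq> 0"
    using degree_monic_char_poly[OF assms] by auto
  then show ?thesis
    unfolding eigenvalue_root_char_poly[OF assms] by (rule poly_roots_finite)
qed

lemma
  fixes K M :: "real mat"
  assumes M: "M \<in> carrier_mat n n" "M\<^sup>T = M" and K: "K \<in> carrier_mat n n" "K\<^sup>T = K" and "0 < n"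
    and pd: "\<And>v. v \<in> carrier_vec n \<Longrightarrow> v \<noteq> 0\<^sub>v n \<Longrightarrow> 0 < quad_form M v"
    and w: "w \<in> carrier_vec n"
  shows lambda_min_le_rayleigh:
      "lambda_min (the (mat_inverse M) * K) * quad_form M w \<le> quad_form K w"
    and rayleigh_le_lambda_max:
      "quad_form K w \<le> lambda_max (the (mat_inverse M) * K) * quad_form M w"
proof -
  let ?I = "the (mat_inverse M)"
  note I = mat_inverse_pos_def[OF M(1) pd]
  have IK: "?I * K \<in> carrier_mat n n" using I K by simp
  have ev: "eigenvalue (?I * K) \<mu>"
    if v: "v \<in> carrier_vec n" "v \<noteq> 0\<^sub>v n" and eq: "K *\<^sub>v v = \<mu> \<cdot>\<^sub>v (M *\<^sub>v v)" for v \<mu>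
  proof -
    have "(?I * K) *\<^sub>v v = ?I *\<^sub>v (\<mu> \<cdot>\<^sub>v (M *\<^sub>v v))"
      using I K v by (simp add: assoc_mult_mat_vec[of _ n n _ n] flip: eq)
    also have "\<dots> = \<mu> \<cdot>\<^sub>v ((?I * M) *\<^sub>v v)"
      using I(1) M v by (simp add: assoc_mult_mat_vec[of _ n n _ n] mult_mat_vec[of _ n n])
    finally show ?thesis
      using I K v by (auto simp: eigenvalue_def eigenvector_def)
  qed
  have q: "0 \<le> quad_form M w"
    using pd[OF w] M by (cases "w = 0\<^sub>v n") (auto simp: quad_form_eq_sum[of _ n])
  obtain \<mu> v where 1: "v \<in> carrier_vec n" "v \<noteq> 0\<^sub>v n" "K *\<^sub>v v = \<mu> \<cdot>\<^sub>v (M *\<^sub>v v)"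
    "\<mu> * quad_form M w \<le> quad_form K w"
    using generalized_rayleigh_minimizer[OF M K \<open>0 < n\<close> pd] w by metis
  have "lambda_min (?I * K) \<le> \<mu>"
    unfolding lambda_min_def using ev[OF 1(1-3)] by (intro Min_le finite_eigenvalues[OF IK]) simp
  then show "lambda_min (?I * K) * quad_form M w \<le> quad_form K w"
    using 1(4) q by (meson mult_right_mono order_trans)
  \<comment> \<open>Minimizing the quotient of \<open>-K\<close> maximizes that of \<open>K\<close>;
    the eigenvalue obtained for \<open>K\<close> is \<open>- \<nu>\<close>.\<close>
  have K': "(-1) \<cdot>\<^sub>m K \<in> carrier_mat n n" "((-1) \<cdot>\<^sub>m K)\<^sup>T = (-1) \<cdot>\<^sub>m K"
    using K by (auto simp: transpose_smult_mat)
  obtain \<nu> u where 2: "u \<in> carrier_vec n" "u \<noteq> 0\<^sub>v n"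
    "((-1) \<cdot>\<^sub>m K) *\<^sub>v u = \<nu> \<cdot>\<^sub>v (M *\<^sub>v u)" "\<nu> * quad_form M w \<le> quad_form ((-1) \<cdot>\<^sub>m K) w"
    using generalized_rayleigh_minimizer[OF M K' \<open>0 < n\<close> pd] w by metis
  have "(-1) \<cdot>\<^sub>v (K *\<^sub>v u) = \<nu> \<cdot>\<^sub>v (M *\<^sub>v u)"
    using 2(1,3) K by (simp add: smult_mat_mult_vec[of _ n n])
  then have "K *\<^sub>v u = (- \<nu>) \<cdot>\<^sub>v (M *\<^sub>v u)"
    using K M 2(1) by (auto simp: vec_eq_iff)
  from ev[OF 2(1,2) this] have "- \<nu> \<le> lambda_max (?I * K)"
    unfolding lambda_max_def by (intro Max_ge finite_eigenvalues[OF IK]) simp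
  then have "- \<nu> * quad_form M w \<le> lambda_max (?I * K) * quad_form M w"
    using q by (intro mult_right_mono)
  moreover have "quad_form K w \<le> - \<nu> * quad_form M w"
    using 2(4) K w by (simp add: quad_form_smult_mat[of _ n])
  ultimately show "quad_form K w \<le> lambda_max (?I * K) * quad_form M w" by simp
qed

section \<open>An inverse estimate on convex sets\<close>

lemma integral_lborel_homothety:
  fixes g :: "'a::euclidean_space \<Rightarrow> real"
  assumes [measurable]: "g \<in> borel_measurable borel" and "c \<noteq> 0"
  shows "(\<integral>x. g x \<partial>lborel) = \<bar>c\<bar> ^ DIM('a) * (\<integral>x. g (t + c *\<^sub>R x) \<partial>lborel)"
proof -
  have "(\<integral>x. g x \<partial>lborel) = (\<integral>x. g x \<partial>density (distr lborel borel (\<lambda>x. t + c *\<^sub>R x)) (\<lambda>_. \<bar>c\<bar> ^ DIM('a)))"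
    by (subst lborel_affine[OF \<open>c \<noteq> 0\<close>, of t]) simp
  also have "\<dots> = \<bar>c\<bar> ^ DIM('a) * (\<integral>x. g (t + c *\<^sub>R x) \<partial>lborel)"
    by (subst integral_density) (auto simp: integral_distr)
  finally show ?thesis .
qed

text \<open>
  The homothety \<open>H x = (p + x) / 2\<close> maps \<open>K\<close> into itself, and \<open>f p = 2 f (H x) - f x\<close> for affine \<open>f\<close>.
\<close>
lemma affine_point_value_le_L2:
  fixes K :: "'a::euclidean_space set"
  assumes K: "compact K" "convex K" and p: "p \<in> K" and f: "\<And>x. x \<in> K \<Longrightarrow> f x = inner a x + b"
  shows "measure lborel K * (f p)\<^sup>2 \<le> (8 * 2 ^ DIM('a) + 2) * (LINT x:K|lborel. (f x)\<^sup>2)"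
proof -
  \<comment> \<open>\<open>f\<close> is arbitrary off \<open>K\<close>; the global affine function
    \<open>F\<close> is Borel measurable and can be evaluated at all points of the space.\<close>
  define F where "F x = inner a x + b" for x
  define H where "H x = (1/2) *\<^sub>R p + (1/2) *\<^sub>R x" for x
  have [measurable]: "K \<in> sets borel" using K by (simp add: borel_compact)
  have [measurable]: "H \<in> borel_measurable borel" by (simp add: H_def[abs_def])
  have [measurable]: "F \<in> borel_measurable borel" by (simp add: F_def[abs_def])
  have contF: "continuous_on A F" for A
    by (auto simp: F_def[abs_def] intro!: continuous_intros)
  have int: "integrable lborel (\<lambda>x. indicator K x * g x)" if "continuous_on K g" for g :: "'a \<Rightarrow> real"
    using borel_integrable_compact[OF K(1) that] by simp
  have HK: "H x \<in> K" if "x \<in> K" for x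
    unfolding H_def using that p K(2) by (intro convexD) auto
  have FH: "F p = 2 * F (H x) - F x" for x
    by (simp add: F_def H_def inner_add_right algebra_simps)
  have contFH: "continuous_on A (\<lambda>x. F (H x))" for A
    by (auto simp: F_def[abs_def] H_def[abs_def] intro!: continuous_intros)
  let ?I = "\<integral>x. indicator K x * (F x)\<^sup>2 \<partial>lborel"
  let ?J = "\<integral>x. indicator K x * (F (H x))\<^sup>2 \<partial>lborel"
  \<comment> \<open>As \<open>H\<close> maps \<open>K\<close> into \<open>K\<close>, the indicator
    at \<open>x\<close> is at most the indicator at \<open>H x\<close>; enlarging it makes the
    integrand a function of \<open>H x\<close> alone, ready for the change of variables.\<close>
  have J: "?J \<le> 2 ^ DIM('a) * ?I"
  proof -
    have i: "integrable lborel (\<lambda>x. indicator K (H x) * (F (H x))\<^sup>2)"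
    proof -
      have "integrable (density (distr lborel borel H) (\<lambda>_. \<bar>1/2::real\<bar> ^ DIM('a))) (\<lambda>x. indicator K x * (F x)\<^sup>2)"
        unfolding H_def by (subst lborel_affine[symmetric]) (auto intro!: int continuous_intros contF)
      then show ?thesis
        by (subst (asm) integrable_density) (auto simp: integrable_distr_eq)
    qed
    have "?J \<le> (\<integral>x. indicator K (H x) * (F (H x))\<^sup>2 \<partial>lborel)"
      using HK by (intro integral_mono int i continuous_intros contFH) (auto simp: indicator_def)
    also have "\<dots> = 2 ^ DIM('a) * ?I"
      unfolding H_def by (subst (2) integral_lborel_homothety[of _ "1/2" "(1/2) *\<^sub>R p"]) (auto simp: power_divide)
    finally show ?thesis .
  qed
  \<comment> \<open>With a = \<open>F (H x)\<close> and b = \<open>F x\<close>, the right side minus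
    \<open>(2 a - b)\<^sup>2\<close> equals \<open>(2 a + b)\<^sup>2\<close>. The 8 is later
    multiplied by the Jacobian bound on \<open>?J\<close>.\<close>
  have pw: "(F p)\<^sup>2 \<le> 8 * (F (H x))\<^sup>2 + 2 * (F x)\<^sup>2" for x
    unfolding FH[of x] using zero_le_power2[of "2 * F (H x) + F x"] by (simp add: power2_eq_square algebra_simps)
  have "measure lborel K * (F p)\<^sup>2 = (\<integral>x. indicator K x * (F p)\<^sup>2 \<partial>lborel)"
    by simp
  also have "\<dots> \<le> (\<integral>x. 8 * (indicator K x * (F (H x))\<^sup>2) + 2 * (indicator K x * (F x)\<^sup>2) \<partial>lborel)"
    using pw by (intro integral_mono Bochner_Integration.integrable_add integrable_mult_right int
        continuous_intros contF contFH) (auto simp: indicator_def)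
  also have "\<dots> = 8 * ?J + 2 * ?I"
    by (subst Bochner_Integration.integral_add) (auto intro!: int continuous_intros contF contFH)
  also have "\<dots> \<le> (8 * 2 ^ DIM('a) + 2) * ?I"
    using J by (simp add: algebra_simps)
  also have "?I = (LINT x:K|lborel. (f x)\<^sup>2)"
    unfolding set_lebesgue_integral_def using f by (intro Bochner_Integration.integral_cong) (auto simp: F_def indicator_def)
  finally show ?thesis using f[OF p] by (simp add: F_def)
qed

section \<open>Mass matrix and its diagonal\<close>

lemma set_integrable_lebesgue_compact:
  fixes g :: "'a::euclidean_space \<Rightarrow> real"
  assumes "compact S" "continuous_on S g" "A \<subseteq> S" "A \<in> sets borel"
  shows "set_integrable lebesgue A g"
proof -
  have "set_integrable lborel S g"
    unfolding set_integrable_def using borel_integrable_compact[OF assms(1,2)] .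
  then have "set_integrable lborel A g"
    using assms(3,4) by (rule_tac set_integrable_subset) auto
  then show ?thesis
    unfolding set_integrable_def by (subst integrable_completion) auto
qed

text \<open>The frontier of a convex set is a null set. This permits replacing elements, which share
  faces, by their interiors.\<close>

lemma set_integral_lebesgue_interior:
  fixes g :: "'a::euclidean_space \<Rightarrow> real"
  assumes "compact K" "convex K" "continuous_on K g"
  shows "(LINT x:interior K|lebesgue. g x) = (LINT x:K|lebesgue. g x)"
proof (rule set_integral_cong_set)
  show "set_borel_measurable lebesgue K g" "set_borel_measurable lebesgue (interior K) g"
    using set_integrable_lebesgue_compact[OF assms(1,3), of K]
      set_integrable_lebesgue_compact[OF assms(1,3) interior_subset] assms(1)
    by (auto simp: set_integrable_def set_borel_measurable_def borel_compact)
  have "AE x in lebesgue. x \<notin> frontier K"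
    using negligible_convex_frontier[OF assms(2)] by (intro AE_not_in) (simp add: negligible_iff_null_sets)
  then show "AE x in lebesgue. (x \<in> K) = (x \<in> interior K)"
  proof eventually_elim
    case (elim x)
    then show ?case
      using closure_closed[OF compact_imp_closed[OF assms(1)]] interior_subset[of K] by (auto simp: frontier_def)
  qed
qed

text \<open>A face that meets the interior of a convex set is the whole set. The intersection is a
  face of both simplices, so an interior common point would make both equal to it.\<close>

lemma interior_disjoint_triangulation:
  assumes "triangulation \<T>" "K \<in> \<T>" "L \<in> \<T>" "K \<noteq> L"
  shows "interior K \<inter> interior L = {}"
proof (rule ccontr)
  assume ne: "interior K \<inter> interior L \<noteq> {}"
  have "K \<inter> L face_of K" "K \<inter> L face_of L"
    using assms(1-3) unfolding triangulation_def by (blast, metis Int_commute)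
  then have "K \<inter> L = K" "K \<inter> L = L"
    using ne interior_subset[of K] interior_subset[of L] face_of_disjoint_interior by blast+
  then show False using assms(4) by simp
qed

text \<open>Fixes a single mesh together with one numbering \<open>x\<close> of its interior nodes,
  which \<open>nodal_basis\<close> only asserts to exist. The constants proved inside must not
  mention the mesh.\<close>

locale fe_mesh =
  fixes \<Omega> :: "(real ^ 'd) set" and \<T> :: "(real ^ 'd) set set" and \<phi> :: "nat \<Rightarrow> real ^ 'd \<Rightarrow> real"
    and x :: "nat \<Rightarrow> real ^ 'd"
  assumes open_domain: "open \<Omega>" and bounded_domain: "bounded \<Omega>"
    and mesh: "admissible_mesh \<Omega> \<T>"
    and nodes: "bij_betw x {..<num_dofs \<Omega> \<T>} (interior_nodes \<Omega> \<T>)"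
    and basis: "\<And>k. k < num_dofs \<Omega> \<T> \<Longrightarrow> \<phi> k \<in> fe_space \<Omega> \<T>"
    and basis_node: "\<And>k l. k < num_dofs \<Omega> \<T> \<Longrightarrow> l < num_dofs \<Omega> \<T> \<Longrightarrow> \<phi> k (x l) = (if l = k then 1 else 0)"
begin

abbreviation "N \<equiv> num_dofs \<Omega> \<T>"

section \<open>Basis functions restricted to one simplex\<close>

definition dofs :: "(real ^ 'd) set \<Rightarrow> nat set" where
  "dofs K = {k. k < N \<and> x k extreme_point_of K}"

definition fe_fun :: "real Matrix.vec \<Rightarrow> real ^ 'd \<Rightarrow> real" where
  "fe_fun v y = (\<Sum>k<N. vec_index v k * \<phi> k y)"

lemma finite_mesh: "finite \<T>" and Union_mesh: "\<Union>\<T> = closure \<Omega>"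
  and triangulation_mesh: "triangulation \<T>"
  using mesh by (auto simp: admissible_mesh_def triangulation_def)

lemma compact_closure_domain: "compact (closure \<Omega>)"
  using bounded_domain by (simp add: compact_closure)

lemma node_in_domain: "k < N \<Longrightarrow> x k \<in> \<Omega>"
  using bij_betw_apply[OF nodes, of k] by (auto simp: interior_nodes_def)

lemma element:
  assumes "K \<in> \<T>"
  obtains C where "finite C" "card C = CARD('d) + 1" "K = convex hull C" "compact K" "convex K"
    "\<And>p. p extreme_point_of K \<longleftrightarrow> p \<in> C" "K \<subseteq> closure \<Omega>"
proof -
  have "int CARD('d) simplex K" using mesh assms by (simp add: admissible_mesh_def)
  then obtain C where C: "\<not> affine_dependent C" "int (card C) = int CARD('d) + 1" "K = convex hull C"
    by (auto simp: simplex_def)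
  have "finite C" using C(1) by (rule aff_independent_finite)
  moreover have "card C = CARD('d) + 1" using C(2) by linarith
  moreover have "p extreme_point_of K \<longleftrightarrow> p \<in> C" for p
    using extreme_point_of_convex_hull_affine_independent[OF C(1)] C(3) by simp
  ultimately show ?thesis
    using that C(3) Union_mesh assms finite_imp_compact_convex_hull by (metis Union_upper convex_convex_hull)
qed

lemma card_dofs_le:
  assumes "K \<in> \<T>"
  shows "finite (dofs K)" "card (dofs K) \<le> CARD('d) + 1"
proof -
  obtain C where C: "finite C" "card C = CARD('d) + 1" "\<And>p. p extreme_point_of K \<longleftrightarrow> p \<in> C"
    using element[OF assms] by metis
  have "inj_on x (dofs K)"
    using nodes by (auto simp: bij_betw_def dofs_def intro: inj_on_subset)
  moreover have "x ` dofs K \<subseteq> C" using C(3) by (auto simp: dofs_def)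
  ultimately show "card (dofs K) \<le> CARD('d) + 1"
    using card_inj_on_le C(1,2) by metis
qed (simp add: dofs_def)

text \<open>Determines every basis function at every vertex: it is 0 on the frontier by
  \<open>fe_space\<close> and a Kronecker delta at an interior node.\<close>

lemma vertex_cases:
  assumes K: "K \<in> \<T>" and p: "p extreme_point_of K"
  obtains "p \<in> frontier \<Omega>" | l where "l \<in> dofs K" "p = x l"
proof (cases "p \<in> \<Omega>")
  case True
  then have "p \<in> interior_nodes \<Omega> \<T>" using K p by (auto simp: interior_nodes_def)
  then obtain l where "l < N" "p = x l"
    using nodes by (auto simp: bij_betw_def)
  then show ?thesis using that(2) p by (simp add: dofs_def)
next
  case False
  have "p \<in> closure \<Omega>" using K p Union_mesh by (auto simp: extreme_point_of_def)
  then show ?thesis using that(1) False open_domain by (simp add: frontier_def interior_open)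
qed

text \<open>On \<open>K\<close> the basis function is affine, so the points where it lies in [0,1],
  and those where it is 0, form convex sets. A convex set that contains the vertices contains their
  hull.\<close>

lemma basis_bounds:
  assumes k: "k < N" and K: "K \<in> \<T>" and y: "y \<in> K"
  shows "0 \<le> \<phi> k y" "\<phi> k y \<le> 1" and "k \<notin> dofs K \<Longrightarrow> \<phi> k y = 0"
proof -
  obtain C where C: "K = convex hull C" "\<And>p. p extreme_point_of K \<longleftrightarrow> p \<in> C"
    using element[OF K] by metis
  obtain a b where ab: "\<And>y. y \<in> K \<Longrightarrow> \<phi> k y = inner a y + b"
    using basis[OF k] K by (fastforce simp: fe_space_def)
  have vertex: "inner a p + b \<in> {0..1} \<and> (k \<notin> dofs K \<longrightarrow> inner a p + b = 0)" if "p \<in> C" for p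
  proof -
    have "p \<in> K" using that C(1) by (simp add: hull_inc)
    show ?thesis
    proof (rule vertex_cases[OF K])
      show "p extreme_point_of K" using C(2) that by simp
    next
      assume "p \<in> frontier \<Omega>"
      then show ?thesis using basis[OF k] ab[OF \<open>p \<in> K\<close>] by (simp add: fe_space_def)
    next
      fix l assume "l \<in> dofs K" "p = x l"
      then show ?thesis using ab[OF \<open>p \<in> K\<close>] basis_node[OF k, of l] by (auto simp: dofs_def split: if_splits)
    qed
  qed
  have "{y. inner a y + b \<in> {0..1}} = {y. - b \<le> inner a y} \<inter> {y. inner a y \<le> 1 - b}"
    by auto
  then have conv: "convex {y. inner a y + b \<in> {0..1}}"
    using convex_Int[OF convex_halfspace_ge[of "- b" a] convex_halfspace_le[of a "1 - b"]] by (simp only:)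
  have "{y. inner a y + b = 0} = {y. inner a y = - b}" by auto
  then have conv0: "convex {y. inner a y + b = 0}"
    using convex_hyperplane[of a "- b"] by (simp only:)
  have "K \<subseteq> {y. inner a y + b \<in> {0..1}}"
    unfolding C(1) by (rule hull_minimal[of _ _ convex]) (use vertex conv in blast)+
  then show "0 \<le> \<phi> k y" "\<phi> k y \<le> 1" using y ab[OF y] by auto
  show "\<phi> k y = 0" if "k \<notin> dofs K"
  proof -
    have "K \<subseteq> {y. inner a y + b = 0}"
      unfolding C(1) by (rule hull_minimal[of _ _ convex]) (use vertex that conv0 in blast)+
    then show ?thesis using y ab[OF y] by auto
  qed
qed

lemma continuous_on_basis: "k < N \<Longrightarrow> continuous_on (closure \<Omega>) (\<phi> k)"
  using basis by (simp add: fe_space_def)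

lemma continuous_on_fe_fun: "continuous_on (closure \<Omega>) (fe_fun v)"
  unfolding fe_fun_def[abs_def] by (intro continuous_intros continuous_on_basis) simp

lemma fe_fun_node:
  assumes "k < N"
  shows "fe_fun v (x k) = vec_index v k"
proof -
  have "fe_fun v (x k) = (\<Sum>l<N. if k = l then vec_index v l else 0)"
    unfolding fe_fun_def using assms by (intro sum.cong) (auto simp: basis_node)
  then show ?thesis using assms by simp
qed

text \<open>Covers both the frontier (boundary condition) and the exterior (extension by zero).
  Elements are only known to lie in the closure of the domain, while the mass integrals run over the
  open domain.\<close>

lemma fe_fun_outside: "y \<notin> \<Omega> \<Longrightarrow> fe_fun v y = 0"
proof -
  assume y: "y \<notin> \<Omega>"
  have "\<phi> k y = 0" if "k < N" for k
    using basis[OF that] y open_domain by (cases "y \<in> closure \<Omega>") (auto simp: fe_space_def frontier_def interior_open)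
  then show ?thesis by (simp add: fe_fun_def)
qed

lemma fe_fun_affine:
  assumes "K \<in> \<T>"
  obtains a b where "\<And>y. y \<in> K \<Longrightarrow> fe_fun v y = inner a y + b"
proof -
  have "\<forall>k<N. \<exists>a b. \<forall>y\<in>K. \<phi> k y = inner a y + b"
    using basis assms by (fastforce simp: fe_space_def)
  then obtain a b where ab: "\<And>k y. k < N \<Longrightarrow> y \<in> K \<Longrightarrow> \<phi> k y = inner (a k) y + b k"
    by metis
  show ?thesis
  proof
    fix y assume "y \<in> K"
    then show "fe_fun v y = inner (\<Sum>k<N. vec_index v k *\<^sub>R a k) y + (\<Sum>k<N. vec_index v k * b k)"
      by (simp add: fe_fun_def ab inner_sum_left ring_distribs sum.distrib)
  qed
qed

lemma fe_fun_sq_le: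
  assumes "y \<in> \<Omega>"
  shows "(fe_fun v y)\<^sup>2 \<le> (CARD('d) + 1) * (\<Sum>k<N. (vec_index v k)\<^sup>2 * (\<phi> k y)\<^sup>2)"
proof -
  obtain K where K: "K \<in> \<T>" "y \<in> K"
    using assms Union_mesh closure_subset by blast
  have "fe_fun v y = (\<Sum>k\<in>dofs K. vec_index v k * \<phi> k y)"
    unfolding fe_fun_def using basis_bounds(3)[OF _ K] by (intro sum.mono_neutral_right) (auto simp: dofs_def)
  also have "\<dots>\<^sup>2 \<le> (\<Sum>k\<in>dofs K. (vec_index v k * \<phi> k y)\<^sup>2) * card (dofs K)"
    using sum_squared_le_sum_of_squares by (simp add: mult.commute)
  also have "\<dots> \<le> (\<Sum>k<N. (vec_index v k * \<phi> k y)\<^sup>2) * (CARD('d) + 1)"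
    using card_dofs_le[OF K(1)]
    by (intro mult_mono sum_mono2 sum_nonneg) (auto simp: dofs_def)
  finally show ?thesis by (simp add: power_mult_distrib mult.commute)
qed

section \<open>The quadratic forms as integrals, and definiteness of the mass matrix\<close>

lemma set_integrable_domain:
  "continuous_on (closure \<Omega>) g \<Longrightarrow> set_integrable lebesgue \<Omega> g" for g :: "real ^ 'd \<Rightarrow> real"
  using set_integrable_lebesgue_compact[OF compact_closure_domain _ closure_subset] open_domain by simp

lemma quad_form_mass_matrix:
  assumes v: "v \<in> carrier_vec N"
  shows "quad_form (mass_matrix \<Omega> \<T> \<phi>) v = (LINT y:\<Omega>|lebesgue. (fe_fun v y)\<^sup>2)"
proof -
  have int: "integrable lebesgue (\<lambda>y. indicator \<Omega> y * (\<phi> k y * \<phi> l y))" if "k < N" "l < N" for k l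
    using set_integrable_domain[of "\<lambda>y. \<phi> k y * \<phi> l y"] continuous_on_basis that
    by (simp add: set_integrable_def continuous_on_mult)
  have "(LINT y:\<Omega>|lebesgue. (fe_fun v y)\<^sup>2)
      = (\<integral>y. (\<Sum>l<N. \<Sum>k<N. (vec_index v k * vec_index v l) * (indicator \<Omega> y * (\<phi> k y * \<phi> l y))) \<partial>lebesgue)"
    unfolding set_lebesgue_integral_def fe_fun_def
    by (intro Bochner_Integration.integral_cong refl)
      (simp add: power2_eq_square sum_product sum_distrib_left ac_simps)
  also have "\<dots> = (\<Sum>l<N. \<Sum>k<N. (vec_index v k * vec_index v l) * (\<integral>y. indicator \<Omega> y * (\<phi> k y * \<phi> l y) \<partial>lebesgue))"
    using int by (subst Bochner_Integration.integral_sum) (auto intro!: sum.cong Bochner_Integration.integral_sum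
        Bochner_Integration.integrable_sum simp: Bochner_Integration.integral_sum)
  also have "\<dots> = quad_form (mass_matrix \<Omega> \<T> \<phi>) v"
    using v by (subst quad_form_eq_sum[of _ N]) (auto simp: mass_matrix_def set_lebesgue_integral_def ac_simps intro!: sum.cong)
  finally show ?thesis ..
qed

lemma quad_form_diag_mass_matrix:
  assumes v: "v \<in> carrier_vec N"
  shows "quad_form (diag_part (mass_matrix \<Omega> \<T> \<phi>)) v
    = (\<Sum>k<N. (vec_index v k)\<^sup>2 * (LINT y:\<Omega>|lebesgue. (\<phi> k y)\<^sup>2))"
proof -
  have carrier: "diag_part (mass_matrix \<Omega> \<T> \<phi>) \<in> carrier_mat N N"
    by (simp add: diag_part_def mass_matrix_def)
  have D: "diag_part (mass_matrix \<Omega> \<T> \<phi>) $$ (l, k)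
      = (if k = l then LINT y:\<Omega>|lebesgue. (\<phi> l y)\<^sup>2 else 0)" if "l < N" "k < N" for l k
    using that by (auto simp: diag_part_def mat_diag_def mass_matrix_def power2_eq_square)
  have "quad_form (diag_part (mass_matrix \<Omega> \<T> \<phi>)) v
    = (\<Sum>l<N. \<Sum>k<N. if k = l then (vec_index v l)\<^sup>2 * (LINT y:\<Omega>|lebesgue. (\<phi> l y)\<^sup>2) else 0)"
    unfolding quad_form_eq_sum[OF carrier v] by (intro sum.cong refl) (simp add: D power2_eq_square)
  also have "\<dots> = (\<Sum>k<N. (vec_index v k)\<^sup>2 * (LINT y:\<Omega>|lebesgue. (\<phi> k y)\<^sup>2))"
    by (intro sum.cong) auto
  finally show ?thesis .
qed

text \<open>If the integral vanished, the set of points of the domain where \<open>fe_fun v\<close>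
  is nonzero would be open and null, hence empty. But it contains the node \<open>x k\<close> of any
  nonzero coordinate, where \<open>fe_fun v\<close> takes the value of that coordinate.\<close>

lemma mass_matrix_pos_def:
  assumes v: "v \<in> carrier_vec N" "v \<noteq> 0\<^sub>v N"
  shows "0 < quad_form (mass_matrix \<Omega> \<T> \<phi>) v"
proof (rule ccontr)
  have int: "integrable lebesgue (\<lambda>y. indicator \<Omega> y * (fe_fun v y)\<^sup>2)"
    using set_integrable_domain[of "\<lambda>y. (fe_fun v y)\<^sup>2"] continuous_on_fe_fun
    by (simp add: set_integrable_def continuous_on_power)
  assume "\<not> 0 < quad_form (mass_matrix \<Omega> \<T> \<phi>) v"
  moreover have "0 \<le> (\<integral>y. indicator \<Omega> y * (fe_fun v y)\<^sup>2 \<partial>lebesgue)"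
    by (intro Bochner_Integration.integral_nonneg) simp
  ultimately have "(\<integral>y. indicator \<Omega> y * (fe_fun v y)\<^sup>2 \<partial>lebesgue) = 0"
    using quad_form_mass_matrix[OF v(1)]
    unfolding set_lebesgue_integral_def real_scaleR_def by linarith
  then have ae: "AE y in lebesgue. indicator \<Omega> y * (fe_fun v y)\<^sup>2 = 0"
    by (subst (asm) integral_nonneg_eq_0_iff_AE[OF int]) auto
  define U where "U = {y \<in> \<Omega>. fe_fun v y \<noteq> 0}"
  have "continuous_on \<Omega> (fe_fun v)"
    using continuous_on_fe_fun closure_subset continuous_on_subset by blast
  then have "open (\<Omega> \<inter> fe_fun v -` (- {0}))"
    using open_domain by (intro continuous_open_preimage) auto
  moreover have "\<Omega> \<inter> fe_fun v -` (- {0}) = U" by (auto simp: U_def)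
  ultimately have "open U" by simp
  moreover have "negligible U"
    using ae unfolding negligible_iff_null_sets
    by (subst AE_iff_null_sets) (use \<open>open U\<close> in \<open>auto simp: U_def elim!: eventually_mono\<close>)
  ultimately have "U = {}" using open_not_negligible by blast
  moreover obtain k where "k < N" "vec_index v k \<noteq> 0"
    using v by (auto simp: vec_eq_iff)
  then have "x k \<in> U" by (simp add: U_def fe_fun_node node_in_domain)
  ultimately show False by blast
qed

section \<open>Two-sided comparison of the mass matrix with its diagonal\<close>

lemma quad_form_mass_le_diag:
  assumes v: "v \<in> carrier_vec N"
  shows "quad_form (mass_matrix \<Omega> \<T> \<phi>) v
    \<le> (CARD('d) + 1) * quad_form (diag_part (mass_matrix \<Omega> \<T> \<phi>)) v"
proof -
  have int: "integrable lebesgue (\<lambda>y. indicator \<Omega> y * (\<phi> k y)\<^sup>2)" if "k < N" for k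
    using set_integrable_domain[of "\<lambda>y. (\<phi> k y)\<^sup>2"] continuous_on_basis[OF that]
    by (simp add: set_integrable_def continuous_on_power)
  have intf: "integrable lebesgue (\<lambda>y. indicator \<Omega> y * (fe_fun v y)\<^sup>2)"
    using set_integrable_domain[of "\<lambda>y. (fe_fun v y)\<^sup>2"] continuous_on_fe_fun
    by (simp add: set_integrable_def continuous_on_power)
  have "(\<integral>y. indicator \<Omega> y * (fe_fun v y)\<^sup>2 \<partial>lebesgue)
      \<le> (\<integral>y. (CARD('d) + 1) * (\<Sum>k<N. (vec_index v k)\<^sup>2 * (indicator \<Omega> y * (\<phi> k y)\<^sup>2)) \<partial>lebesgue)"
    using fe_fun_sq_le
    by (intro integral_mono intf integrable_mult_right Bochner_Integration.integrable_sum int)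
      (auto simp: indicator_def)
  also have "\<dots> = (CARD('d) + 1) * (\<Sum>k<N. (vec_index v k)\<^sup>2 * (\<integral>y. indicator \<Omega> y * (\<phi> k y)\<^sup>2 \<partial>lebesgue))"
    using int by (subst integral_mult_right_zero) (auto simp: Bochner_Integration.integral_sum)
  finally show ?thesis
    using v by (simp add: quad_form_mass_matrix quad_form_diag_mass_matrix set_lebesgue_integral_def)
qed

lemma element_value_le_L2:
  assumes K: "K \<in> \<T>" and k: "k \<in> dofs K"
  shows "measure lebesgue K * (vec_index v k)\<^sup>2
    \<le> (8 * 2 ^ CARD('d) + 2) * (LINT y:K|lebesgue. (fe_fun v y)\<^sup>2)"
proof -
  obtain a b where ab: "\<And>y. y \<in> K \<Longrightarrow> fe_fun v y = inner a y + b"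
    using fe_fun_affine[OF K] by metis
  have cK: "compact K" "convex K" "K \<subseteq> closure \<Omega>" using element[OF K] by metis+
  have "k < N" "x k \<in> K" using k by (auto simp: dofs_def extreme_point_of_def)
  \<comment> \<open>The affine estimate is over \<open>lborel\<close>. Cut off to \<open>K\<close>,
    the function agrees with a Borel function, so its integral over the completed measure is the
    same.\<close>
  have "(\<lambda>y. indicator K y * (fe_fun v y)\<^sup>2) = (\<lambda>y. indicator K y * (inner a y + b)\<^sup>2)"
    using ab by (auto simp: indicator_def)
  moreover have [measurable]: "K \<in> sets borel" using cK(1) by (rule borel_compact)
  have "(\<lambda>y. indicator K y * (inner a y + b)\<^sup>2) \<in> borel_measurable borel"
    by measurable
  ultimately have "(\<lambda>y. indicator K y * (fe_fun v y)\<^sup>2) \<in> borel_measurable borel"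
    by simp
  then have "(LINT y:K|lebesgue. (fe_fun v y)\<^sup>2) = (LINT y:K|lborel. (fe_fun v y)\<^sup>2)"
    by (simp add: set_lebesgue_integral_def integral_completion)
  then show ?thesis
    using affine_point_value_le_L2[OF cK(1,2) \<open>x k \<in> K\<close> ab] fe_fun_node[OF \<open>k < N\<close>] cK(1)
    by (simp add: measure_completion borel_compact)
qed

lemma integral_basis_sq_le:
  assumes k: "k < N"
  shows "(LINT y:\<Omega>|lebesgue. (\<phi> k y)\<^sup>2) \<le> (\<Sum>K\<in>\<T>. if k \<in> dofs K then measure lebesgue K else 0)"
proof -
  have int: "integrable lebesgue (indicator K :: _ \<Rightarrow> real)" if "K \<in> \<T>" for K
  proof -
    have "K \<in> lmeasurable"
      using element[OF that] lmeasurable_compact by metis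
    then show ?thesis by (intro integrable_real_indicator) (auto simp: fmeasurable_def)
  qed
  have "(LINT y:\<Omega>|lebesgue. (\<phi> k y)\<^sup>2)
      \<le> (\<integral>y. (\<Sum>K\<in>\<T>. (if k \<in> dofs K then 1 else 0) * indicator K y) \<partial>lebesgue)"
    unfolding set_lebesgue_integral_def
  proof (intro integral_mono Bochner_Integration.integrable_sum integrable_mult_right)
    show "integrable lebesgue (\<lambda>y. indicator \<Omega> y *\<^sub>R (\<phi> k y)\<^sup>2)"
      using set_integrable_domain[of "\<lambda>y. (\<phi> k y)\<^sup>2"] continuous_on_basis[OF k]
      by (simp add: set_integrable_def continuous_on_power)
    show "integrable lebesgue (indicator K :: _ \<Rightarrow> real)" if "K \<in> \<T>" for K
      using that by (rule int)
    fix y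
    have nn: "0 \<le> (\<Sum>K\<in>\<T>. (if k \<in> dofs K then 1 else 0) * indicator K y :: real)"
      by (intro sum_nonneg) simp
    show "indicator \<Omega> y *\<^sub>R (\<phi> k y)\<^sup>2 \<le> (\<Sum>K\<in>\<T>. (if k \<in> dofs K then 1 else 0) * indicator K y)"
    proof (cases "y \<in> \<Omega> \<and> \<phi> k y \<noteq> 0")
      case True
      \<comment> \<open>One element containing \<open>y\<close> suffices: further elements through
        \<open>y\<close> only enlarge the nonnegative sum on the right.\<close>
      then obtain K where K: "K \<in> \<T>" "y \<in> K"
        using Union_mesh closure_subset by blast
      have "(\<phi> k y)\<^sup>2 \<le> 1"
        using basis_bounds[OF k K] by (simp add: power_le_one)
      also have "1 = (if k \<in> dofs K then 1 else 0) * (indicator K y :: real)"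
        using basis_bounds(3)[OF k K] True K(2) by auto
      also have "\<dots> \<le> (\<Sum>K\<in>\<T>. (if k \<in> dofs K then 1 else 0) * indicator K y)"
        using K(1) finite_mesh by (intro member_le_sum) auto
      finally show ?thesis using True by simp
    qed (use nn in auto)
  qed
  also have "\<dots> = (\<Sum>K\<in>\<T>. (if k \<in> dofs K then 1 else 0) * measure lebesgue K)"
    using int by (subst Bochner_Integration.integral_sum) (auto intro!: sum.cong)
  finally show ?thesis by (simp add: if_distrib[of "\<lambda>c. c * _"] cong: if_cong)
qed

text \<open>With closed elements the pointwise inequality can fail on shared faces, which are
  counted several times. Hence the passage to interiors, which are pairwise disjoint.\<close>

lemma sum_elements_le_integral:
  "(\<Sum>K\<in>\<T>. LINT y:K|lebesgue. (fe_fun v y)\<^sup>2) \<le> (LINT y:\<Omega>|lebesgue. (fe_fun v y)\<^sup>2)"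
proof -
  have cont: "continuous_on (closure \<Omega>) (\<lambda>y. (fe_fun v y)\<^sup>2)"
    by (intro continuous_intros continuous_on_fe_fun)
  have sub: "compact K" "convex K" "K \<subseteq> closure \<Omega>" if "K \<in> \<T>" for K
    using element[OF that] by metis+
  have int: "integrable lebesgue (\<lambda>y. indicator (interior K) y *\<^sub>R (fe_fun v y)\<^sup>2)" if "K \<in> \<T>" for K
    using set_integrable_lebesgue_compact[OF compact_closure_domain cont, of "interior K"] sub(3)[OF that] interior_subset[of K]
    by (auto simp: set_integrable_def)
  have "(\<Sum>K\<in>\<T>. LINT y:K|lebesgue. (fe_fun v y)\<^sup>2) = (\<Sum>K\<in>\<T>. LINT y:interior K|lebesgue. (fe_fun v y)\<^sup>2)"
    using sub continuous_on_subset[OF cont] by (intro sum.cong) (auto simp: set_integral_lebesgue_interior)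
  also have "\<dots> = (\<integral>y. (\<Sum>K\<in>\<T>. indicator (interior K) y *\<^sub>R (fe_fun v y)\<^sup>2) \<partial>lebesgue)"
    unfolding set_lebesgue_integral_def using int by (simp add: Bochner_Integration.integral_sum)
  also have "\<dots> \<le> (LINT y:\<Omega>|lebesgue. (fe_fun v y)\<^sup>2)"
    unfolding set_lebesgue_integral_def
  proof (intro integral_mono Bochner_Integration.integrable_sum int)
    show "integrable lebesgue (\<lambda>y. indicator \<Omega> y *\<^sub>R (fe_fun v y)\<^sup>2)"
      using set_integrable_domain[OF cont] by (simp add: set_integrable_def)
    fix y
    have "disjoint_family_on interior \<T>"
      using interior_disjoint_triangulation[OF triangulation_mesh] by (auto simp: disjoint_family_on_def)
    then have "(\<Sum>K\<in>\<T>. indicator (interior K) y :: real) = indicator (\<Union>(interior ` \<T>)) y"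
      using finite_mesh by (simp add: indicator_UN_disjoint)
    also have "\<dots> \<le> 1" by (simp add: indicator_def)
    finally have "(\<Sum>K\<in>\<T>. indicator (interior K) y) * (fe_fun v y)\<^sup>2 \<le> (fe_fun v y)\<^sup>2"
      by (simp add: mult_left_le_one_le sum_nonneg)
    then show "(\<Sum>K\<in>\<T>. indicator (interior K) y *\<^sub>R (fe_fun v y)\<^sup>2) \<le> indicator \<Omega> y *\<^sub>R (fe_fun v y)\<^sup>2"
      using fe_fun_outside[of y v] by (cases "y \<in> \<Omega>") (auto simp: sum_distrib_right)
  qed
  finally show ?thesis .
qed

text \<open>Exchanging the sums over nodes and elements puts each \<open>measure lebesgue K\<close>
  next to a value of \<open>fe_fun v\<close> at a vertex of the same \<open>K\<close>, where
  \<open>element_value_le_L2\<close> applies. The factor d + 1 counts the vertices of an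
  element.\<close>

lemma quad_form_diag_le_mass:
  assumes v: "v \<in> carrier_vec N"
  shows "quad_form (diag_part (mass_matrix \<Omega> \<T> \<phi>)) v
    \<le> real (CARD('d) + 1) * (8 * 2 ^ CARD('d) + 2) * quad_form (mass_matrix \<Omega> \<T> \<phi>) v"
proof -
  let ?D = "8 * 2 ^ CARD('d) + 2 :: real"
  let ?I = "\<lambda>K. LINT y:K|lebesgue. (fe_fun v y)\<^sup>2"
  have "quad_form (diag_part (mass_matrix \<Omega> \<T> \<phi>)) v
      \<le> (\<Sum>k<N. (vec_index v k)\<^sup>2 * (\<Sum>K\<in>\<T>. if k \<in> dofs K then measure lebesgue K else 0))"
    unfolding quad_form_diag_mass_matrix[OF v]
    by (intro sum_mono mult_left_mono integral_basis_sq_le) auto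
  also have "\<dots> = (\<Sum>K\<in>\<T>. \<Sum>k<N. if k \<in> dofs K then measure lebesgue K * (vec_index v k)\<^sup>2 else 0)"
    by (subst sum.swap) (auto simp: sum_distrib_left intro!: sum.cong)
  also have "\<dots> = (\<Sum>K\<in>\<T>. \<Sum>k\<in>dofs K. measure lebesgue K * (vec_index v k)\<^sup>2)"
    by (intro sum.cong refl sum.mono_neutral_cong_right) (auto simp: dofs_def)
  also have "\<dots> \<le> (\<Sum>K\<in>\<T>. (CARD('d) + 1) * (?D * ?I K))"
  proof (rule sum_mono)
    fix K assume K: "K \<in> \<T>"
    have "0 \<le> ?I K" by (simp add: set_lebesgue_integral_def)
    have "(\<Sum>k\<in>dofs K. measure lebesgue K * (vec_index v k)\<^sup>2) \<le> of_nat (card (dofs K)) * (?D * ?I K)"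
      by (rule sum_bounded_above) (rule element_value_le_L2[OF K])
    also have "\<dots> \<le> (CARD('d) + 1) * (?D * ?I K)"
      using card_dofs_le(2)[OF K] \<open>0 \<le> ?I K\<close> by (intro mult_right_mono mult_nonneg_nonneg) auto
    finally show "(\<Sum>k\<in>dofs K. measure lebesgue K * (vec_index v k)\<^sup>2) \<le> (CARD('d) + 1) * (?D * ?I K)" .
  qed
  also have "\<dots> = real (CARD('d) + 1) * ?D * (\<Sum>K\<in>\<T>. ?I K)"
    by (simp add: sum_distrib_left mult.assoc)
  also have "\<dots> \<le> real (CARD('d) + 1) * ?D * quad_form (mass_matrix \<Omega> \<T> \<phi>) v"
    unfolding quad_form_mass_matrix[OF v] by (intro mult_left_mono sum_elements_le_integral) simp
  finally show ?thesis .
qed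

section \<open>Spectral equivalences\<close>

lemma
  assumes bounds: "MK_spectral_bounds c C \<Omega> \<T> \<phi>" and "0 < C" and v: "v \<in> carrier_vec N"
  defines "h \<equiv> mesh_size \<T>"
  shows quad_form_stiffness_lower:
      "c * quad_form (mass_matrix \<Omega> \<T> \<phi>) v \<le> quad_form (stiffness_matrix \<Omega> \<T> \<phi>) v"
    and quad_form_stiffness_upper:
      "h\<^sup>2 * quad_form (stiffness_matrix \<Omega> \<T> \<phi>) v \<le> C * quad_form (mass_matrix \<Omega> \<T> \<phi>) v"
proof -
  let ?M = "mass_matrix \<Omega> \<T> \<phi>" and ?K = "stiffness_matrix \<Omega> \<T> \<phi>"
  have M: "?M \<in> carrier_mat N N" "?M\<^sup>T = ?M" and K: "?K \<in> carrier_mat N N" "?K\<^sup>T = ?K"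
    by (auto simp: mass_matrix_def stiffness_matrix_def inner_commute mult.commute)
  have "c * quad_form ?M v \<le> quad_form ?K v \<and> h\<^sup>2 * quad_form ?K v \<le> C * quad_form ?M v"
  proof (cases "N = 0")
    \<comment> \<open>Without interior nodes \<open>MK_spectral_bounds\<close> says nothing, but
      both forms are empty sums.\<close>
    case True
    then show ?thesis using M K v by (simp add: quad_form_eq_sum[of _ N])
  next
    case False
    define MK where "MK = the (mat_inverse ?M) * ?K"
    have l: "c \<le> lambda_min MK" and u: "lambda_max MK \<le> C / h\<^sup>2"
      using bounds False by (simp_all add: MK_spectral_bounds_def Let_def MK_def h_def)
    have q: "0 \<le> quad_form ?M v"
      unfolding quad_form_mass_matrix[OF v] by (simp add: set_lebesgue_integral_def)
    have "lambda_min MK * quad_form ?M v \<le> quad_form ?K v"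
      and "quad_form ?K v \<le> lambda_max MK * quad_form ?M v"
      using lambda_min_le_rayleigh[OF M K _ mass_matrix_pos_def v] rayleigh_le_lambda_max[OF M K _ mass_matrix_pos_def v] False
      by (simp_all add: MK_def)
    moreover have "c * quad_form ?M v \<le> lambda_min MK * quad_form ?M v"
      and "lambda_max MK * quad_form ?M v \<le> C / h\<^sup>2 * quad_form ?M v"
      using l u q by (intro mult_right_mono; simp)+
    ultimately have 1: "c * quad_form ?M v \<le> quad_form ?K v" "quad_form ?K v \<le> C / h\<^sup>2 * quad_form ?M v"
      by linarith+
    have "h\<^sup>2 * quad_form ?K v \<le> h\<^sup>2 * (C / h\<^sup>2 * quad_form ?M v)"
      using 1(2) by (rule mult_left_mono) simp
    \<comment> \<open>An inequality rather than an equality: for \<open>h = 0\<close> the left side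
      is 0 and the right side is nonnegative.\<close>
    also have "\<dots> \<le> C * quad_form ?M v"
      using \<open>0 < C\<close> q by (cases "h = 0") simp_all
    finally show ?thesis using 1(1) by simp
  qed
  then show "c * quad_form ?M v \<le> quad_form ?K v" "h\<^sup>2 * quad_form ?K v \<le> C * quad_form ?M v"
    by auto
qed

lemma A_matrix_eq:
  "A_matrix (h ^ 4) \<Omega> \<T> \<phi> = mass_matrix \<Omega> \<T> \<phi> + h\<^sup>2 \<cdot>\<^sub>m stiffness_matrix \<Omega> \<T> \<phi>"
proof -
  have "sqrt (h ^ 4) = sqrt ((h\<^sup>2)\<^sup>2)" by (simp add: power_mult[symmetric])
  also have "\<dots> = h\<^sup>2" by (subst real_sqrt_abs) simp
  finally show ?thesis by (simp add: A_matrix_def)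
qed

lemma quad_form_A_bounds:
  assumes "MK_spectral_bounds c C \<Omega> \<T> \<phi>" and "0 < C" and v: "v \<in> carrier_vec N"
  defines "h \<equiv> mesh_size \<T>"
  shows "(1 + h\<^sup>2 * c) * quad_form (mass_matrix \<Omega> \<T> \<phi>) v \<le> quad_form (A_matrix (h ^ 4) \<Omega> \<T> \<phi>) v"
    and "quad_form (A_matrix (h ^ 4) \<Omega> \<T> \<phi>) v \<le> (1 + C) * quad_form (mass_matrix \<Omega> \<T> \<phi>) v"
proof -
  let ?M = "mass_matrix \<Omega> \<T> \<phi>" and ?K = "stiffness_matrix \<Omega> \<T> \<phi>"
  have MK: "?M \<in> carrier_mat N N" "?K \<in> carrier_mat N N"
    by (simp_all add: mass_matrix_def stiffness_matrix_def)
  have A: "quad_form (A_matrix (h ^ 4) \<Omega> \<T> \<phi>) v = quad_form ?M v + h\<^sup>2 * quad_form ?K v"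
    unfolding A_matrix_eq using MK v
    by (subst quad_form_add_mat[of _ N]) (auto simp: quad_form_smult_mat[of _ N])
  have "h\<^sup>2 * (c * quad_form ?M v) \<le> h\<^sup>2 * quad_form ?K v"
    using quad_form_stiffness_lower[OF assms(1-3)] by (rule mult_left_mono) simp
  then show "(1 + h\<^sup>2 * c) * quad_form ?M v \<le> quad_form (A_matrix (h ^ 4) \<Omega> \<T> \<phi>) v"
    unfolding A by (simp add: algebra_simps)
  show "quad_form (A_matrix (h ^ 4) \<Omega> \<T> \<phi>) v \<le> (1 + C) * quad_form ?M v"
    unfolding A using quad_form_stiffness_upper[OF assms(1-3)] by (simp add: h_def algebra_simps)
qed

end

lemma fe_discretization_imp_fe_mesh:
  assumes "bounded_lipschitz_domain \<Omega>" and "fe_discretization \<Omega> \<sigma> \<kappa> \<T> \<phi>"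
  obtains x where "fe_mesh \<Omega> \<T> \<phi> x"
proof -
  obtain x where "bij_betw x {..<num_dofs \<Omega> \<T>} (interior_nodes \<Omega> \<T>)"
    "\<forall>k < num_dofs \<Omega> \<T>. \<phi> k \<in> fe_space \<Omega> \<T> \<and>
             (\<forall>l < num_dofs \<Omega> \<T>. \<phi> k (x l) = (if l = k then 1 else 0))"
    using assms(2) unfolding fe_discretization_def nodal_basis_def by blast
  then have "fe_mesh \<Omega> \<T> \<phi> x"
    using assms by unfold_locales (auto simp: bounded_lipschitz_domain_def fe_discretization_def)
  then show ?thesis by (rule that)
qed


theorem mainTheorem4:
  fixes \<Omega> :: "(real ^ 'd) set"
    and \<sigma> \<kappa> c\<^sub>M\<^sub>K C\<^sub>M\<^sub>K :: real
  assumes "CARD('d) \<in> {1, 2, 3}"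
    and "bounded_lipschitz_domain \<Omega>"
    and "0 < c\<^sub>M\<^sub>K" and "0 < C\<^sub>M\<^sub>K"
  shows
    "(\<forall>\<T> \<phi>. fe_discretization \<Omega> \<sigma> \<kappa> \<T> \<phi> \<and> MK_spectral_bounds c\<^sub>M\<^sub>K C\<^sub>M\<^sub>K \<Omega> \<T> \<phi> \<longrightarrow>
        (let h = mesh_size \<T>; \<rho> = h ^ 4;
             M = mass_matrix \<Omega> \<T> \<phi>; K = stiffness_matrix \<Omega> \<T> \<phi>; A = A_matrix \<rho> \<Omega> \<T> \<phi>
         in A = M + h\<^sup>2 \<cdot>\<^sub>m K \<and>
            (\<forall>v \<in> carrier_vec (num_dofs \<Omega> \<T>).
               (1 + h\<^sup>2 * c\<^sub>M\<^sub>K) * quad_form M v \<le> quad_form A v \<and>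
               quad_form A v \<le> (1 + C\<^sub>M\<^sub>K) * quad_form M v)))
     \<and>
     (\<exists>c\<^sub>C\<^sub>A C\<^sub>C\<^sub>A. 0 < c\<^sub>C\<^sub>A \<and> 0 < C\<^sub>C\<^sub>A \<and>
        (\<forall>\<T> \<phi>. fe_discretization \<Omega> \<sigma> \<kappa> \<T> \<phi> \<and> MK_spectral_bounds c\<^sub>M\<^sub>K C\<^sub>M\<^sub>K \<Omega> \<T> \<phi> \<longrightarrow>
          (let h = mesh_size \<T>; \<rho> = h ^ 4;
               A = A_matrix \<rho> \<Omega> \<T> \<phi>; C = diag_part (mass_matrix \<Omega> \<T> \<phi>)
           in \<forall>v \<in> carrier_vec (num_dofs \<Omega> \<T>).
                c\<^sub>C\<^sub>A * quad_form C v \<le> quad_form A v \<and>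
                quad_form A v \<le> C\<^sub>C\<^sub>A * quad_form C v)))"
proof (intro conjI)
  show "\<forall>\<T> \<phi>. fe_discretization \<Omega> \<sigma> \<kappa> \<T> \<phi> \<and> MK_spectral_bounds c\<^sub>M\<^sub>K C\<^sub>M\<^sub>K \<Omega> \<T> \<phi> \<longrightarrow>
        (let h = mesh_size \<T>; \<rho> = h ^ 4;
             M = mass_matrix \<Omega> \<T> \<phi>; K = stiffness_matrix \<Omega> \<T> \<phi>; A = A_matrix \<rho> \<Omega> \<T> \<phi>
         in A = M + h\<^sup>2 \<cdot>\<^sub>m K \<and>
            (\<forall>v \<in> carrier_vec (num_dofs \<Omega> \<T>).
               (1 + h\<^sup>2 * c\<^sub>M\<^sub>K) * quad_form M v \<le> quad_form A v \<and>
               quad_form A v \<le> (1 + C\<^sub>M\<^sub>K) * quad_form M v))"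
    unfolding Let_def
  proof (intro allI impI)
    fix \<T> :: "(real ^ 'd) set set" and \<phi>
    assume a: "fe_discretization \<Omega> \<sigma> \<kappa> \<T> \<phi> \<and> MK_spectral_bounds c\<^sub>M\<^sub>K C\<^sub>M\<^sub>K \<Omega> \<T> \<phi>"
    then obtain x where "fe_mesh \<Omega> \<T> \<phi> x"
      using fe_discretization_imp_fe_mesh[OF assms(2)] by blast
    then interpret fe_mesh \<Omega> \<T> \<phi> x .
    let ?h = "mesh_size \<T>" and ?M = "mass_matrix \<Omega> \<T> \<phi>"
    show "A_matrix (?h ^ 4) \<Omega> \<T> \<phi> = ?M + ?h\<^sup>2 \<cdot>\<^sub>m stiffness_matrix \<Omega> \<T> \<phi> \<and>
      (\<forall>v \<in> carrier_vec N.
        (1 + ?h\<^sup>2 * c\<^sub>M\<^sub>K) * quad_form ?M v \<le> quad_form (A_matrix (?h ^ 4) \<Omega> \<T> \<phi>) v \<and>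
        quad_form (A_matrix (?h ^ 4) \<Omega> \<T> \<phi>) v \<le> (1 + C\<^sub>M\<^sub>K) * quad_form ?M v)"
      using quad_form_A_bounds[of c\<^sub>M\<^sub>K C\<^sub>M\<^sub>K] a assms(4) by (simp add: A_matrix_eq)
  qed
next
  let ?n = "real (CARD('d) + 1)"
  \<comment> \<open>\<open>?c\<close> inverts the constant of \<open>quad_form_diag_le_mass\<close>;
    \<open>?C\<close> multiplies the upper bounds of A by M and of M by its diagonal.\<close>
  let ?c = "1 / (?n * (8 * 2 ^ CARD('d) + 2))" and ?C = "(1 + C\<^sub>M\<^sub>K) * ?n"
  have D: "0 < ?n * (8 * 2 ^ CARD('d) + 2)" by (intro mult_pos_pos add_pos_pos) auto
  have "?c * quad_form (diag_part (mass_matrix \<Omega> \<T> \<phi>)) v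
        \<le> quad_form (A_matrix (mesh_size \<T> ^ 4) \<Omega> \<T> \<phi>) v
      \<and> quad_form (A_matrix (mesh_size \<T> ^ 4) \<Omega> \<T> \<phi>) v
        \<le> ?C * quad_form (diag_part (mass_matrix \<Omega> \<T> \<phi>)) v"
    if fe: "fe_discretization \<Omega> \<sigma> \<kappa> \<T> \<phi>" and b: "MK_spectral_bounds c\<^sub>M\<^sub>K C\<^sub>M\<^sub>K \<Omega> \<T> \<phi>"
      and v: "v \<in> carrier_vec (num_dofs \<Omega> \<T>)" for \<T> \<phi> v
  proof -
    obtain x where "fe_mesh \<Omega> \<T> \<phi> x"
      using fe_discretization_imp_fe_mesh[OF assms(2) fe] .
    then interpret fe_mesh \<Omega> \<T> \<phi> x .
    let ?M = "mass_matrix \<Omega> \<T> \<phi>" and ?h = "mesh_size \<T>"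
    have q: "0 \<le> quad_form ?M v"
      unfolding quad_form_mass_matrix[OF v] by (simp add: set_lebesgue_integral_def)
    have "?c * quad_form (diag_part ?M) v \<le> quad_form ?M v"
      using quad_form_diag_le_mass[OF v] D by (simp add: pos_divide_le_eq mult.commute)
    \<comment> \<open>The factor depends on the mesh size but is at least 1, so the lower constant
      can be taken free of it.\<close>
    also have "\<dots> \<le> (1 + ?h\<^sup>2 * c\<^sub>M\<^sub>K) * quad_form ?M v"
      using q assms(3) by (simp add: mult_le_cancel_right1)
    also have "\<dots> \<le> quad_form (A_matrix (?h ^ 4) \<Omega> \<T> \<phi>) v"
      by (rule quad_form_A_bounds(1)[OF b assms(4) v])
    finally have lower: "?c * quad_form (diag_part ?M) v \<le> quad_form (A_matrix (?h ^ 4) \<Omega> \<T> \<phi>) v" .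
    have "quad_form (A_matrix (?h ^ 4) \<Omega> \<T> \<phi>) v \<le> (1 + C\<^sub>M\<^sub>K) * quad_form ?M v"
      by (rule quad_form_A_bounds(2)[OF b assms(4) v])
    also have "\<dots> \<le> (1 + C\<^sub>M\<^sub>K) * (?n * quad_form (diag_part ?M) v)"
      using assms(4) by (intro mult_left_mono quad_form_mass_le_diag[OF v]) simp
    finally show ?thesis using lower by (simp only: mult.assoc)
  qed
  moreover have "0 < ?c" "0 < ?C"
    using D assms(4) by (auto intro!: mult_pos_pos)
  ultimately have "0 < ?c \<and> 0 < ?C \<and> (\<forall>\<T> \<phi>. fe_discretization \<Omega> \<sigma> \<kappa> \<T> \<phi> \<and> MK_spectral_bounds c\<^sub>M\<^sub>K C\<^sub>M\<^sub>K \<Omega> \<T> \<phi> \<longrightarrow>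
      (\<forall>v \<in> carrier_vec (num_dofs \<Omega> \<T>).
        ?c * quad_form (diag_part (mass_matrix \<Omega> \<T> \<phi>)) v
          \<le> quad_form (A_matrix (mesh_size \<T> ^ 4) \<Omega> \<T> \<phi>) v \<and>
        quad_form (A_matrix (mesh_size \<T> ^ 4) \<Omega> \<T> \<phi>) v
          \<le> ?C * quad_form (diag_part (mass_matrix \<Omega> \<T> \<phi>)) v))"
    by simp
  then show "\<exists>c\<^sub>C\<^sub>A C\<^sub>C\<^sub>A. 0 < c\<^sub>C\<^sub>A \<and> 0 < C\<^sub>C\<^sub>A \<and>
        (\<forall>\<T> \<phi>. fe_discretization \<Omega> \<sigma> \<kappa> \<T> \<phi> \<and> MK_spectral_bounds c\<^sub>M\<^sub>K C\<^sub>M\<^sub>K \<Omega> \<T> \<phi> \<longrightarrow>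
          (let h = mesh_size \<T>; \<rho> = h ^ 4;
               A = A_matrix \<rho> \<Omega> \<T> \<phi>; C = diag_part (mass_matrix \<Omega> \<T> \<phi>)
           in \<forall>v \<in> carrier_vec (num_dofs \<Omega> \<T>).
                c\<^sub>C\<^sub>A * quad_form C v \<le> quad_form A v \<and>
                quad_form A v \<le> C\<^sub>C\<^sub>A * quad_form C v))"
    unfolding Let_def by (intro exI[of _ ?c] exI[of _ ?C])
qed

end
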